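(* Let $n\ge 2$, $\delta\in[0,1]$, $c\in[0,1]^n$ with $\sum_{k=1}^n c_k=1$, and $o\in[0,1]^n$. Let $\sigma$ be a permutation of $\{1,\dots,n\}$ that orders $o$ decreasingly, i.e. $o_{\sigma(1)}\ge o_{\sigma(2)}\ge\dots\ge o_{\sigma(n)}$. If $x^*\in[0,1]^n$ is an optimal solution of $$\min_{x\in[0,1]^n}\ \xi_{c_\sigma}^{o_\sigma}(x)\quad\text{subject to}\quad x_1\ge x_2\ge\dots\ge x_n,\qquad x_1-x_n\le\delta,$$ then $x^*_{\sigma^{-1}}$ is an optimal solution of the problem $\min_{x\in\mathcal{R}_\delta}\xi_c^o(x)$.
   Context: For $c,o,x\in[0,1]^n$, $\xi_c^o(x)=\sum_{k=1}^n c_k|x_k-o_k|$. For a vector $y$ of length $n$ and a permutation $\sigma$ of $\{1,\dots,n\}$, $y_\sigma=(y_{\sigma(1)},\dots,y_{\sigma(n)})$. The mutual consensus measure is $\kappa(x)=\max_{1\le i<j\le n}|x_i-x_j|$ for $x\in[0,1]^n$, and $\mathcal{R}_\delta=\{x\in[0,1]^n:\kappa(x)\le\delta\}$. *)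

theory Defs
  imports Complex_Main "HOL-Library.FuncSet" "HOL-Combinatorics.Permutations"
begin

(* A vector y of length n is a function on {1..n}, extended by "undefined" outside that set.
   If \<sigma> permutes {1..n}, it fixes everything outside {1..n}, so the rearranged vector
   (y (\<sigma> 1), ..., y (\<sigma> n)) is again of this form and equals y \<circ> \<sigma>. *)

definition unit_cube :: "nat \<Rightarrow> (nat \<Rightarrow> real) set"
  where "unit_cube n = {1..n} \<rightarrow>\<^sub>E {0..1}"

definition xi :: "nat \<Rightarrow> (nat \<Rightarrow> real) \<Rightarrow> (nat \<Rightarrow> real) \<Rightarrow> (nat \<Rightarrow> real) \<Rightarrow> real"
  where "xi n c a x = (\<Sum>k = 1..n. c k * \<bar>x k - a k\<bar>)"

(* The maximum is over a nonempty set only for n \<ge> 2. *)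
definition kappa :: "nat \<Rightarrow> (nat \<Rightarrow> real) \<Rightarrow> real"
  where "kappa n x = Max {\<bar>x i - x j\<bar> |i j. 1 \<le> i \<and> i < j \<and> j \<le> n}"

definition consensus_region :: "nat \<Rightarrow> real \<Rightarrow> (nat \<Rightarrow> real) set"
  where "consensus_region n \<delta> = {x \<in> unit_cube n. kappa n x \<le> \<delta>}"

end

theory Submission
  imports Defs
begin

text \<open>
  The coordinates of a competitor \<open>y\<close> lie in an interval of length at most \<open>\<delta>\<close>, namely from
  its smallest coordinate to its largest one. Projecting each target \<open>a k\<close> onto that interval
  gives a point that is at least as close to \<open>a k\<close> as \<open>y k\<close> is, so for nonnegative weights the
  projected vector costs no more than \<open>y\<close> (\<open>xi_clamp_le\<close>). The projection is a monotone map of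
  the target, so the projected vector is ordered in the same way as \<open>a\<close>. Hence restricting
  attention to vectors ordered like \<open>a\<close> does not raise the minimum, although reordering the
  coordinates of \<open>y\<close> could raise its cost, as the weights differ. For vectors ordered in this
  way, the mutual consensus is the difference of the first and the last entry after sorting by
  \<open>\<sigma>\<close>, and the cost does not depend on the numbering of the coordinates (\<open>xi_permute\<close>); so
  the ordered problem is the consensus problem restricted to these vectors.
\<close>

definition clamp_to :: "real \<Rightarrow> real \<Rightarrow> real \<Rightarrow> real"
  where "clamp_to l u t = max l (min u t)"

lemma clamp_to_mem: "l \<le> u \<Longrightarrow> l \<le> clamp_to l u t \<and> clamp_to l u t \<le> u"
  by (auto simp: clamp_to_def)

lemma clamp_to_mono: "s \<le> t \<Longrightarrow> clamp_to l u s \<le> clamp_to l u t"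
  by (auto simp: clamp_to_def)

lemma clamp_to_nearest:
  assumes "l \<le> v" "v \<le> u"
  shows "\<bar>clamp_to l u t - t\<bar> \<le> \<bar>v - t\<bar>"
  using assms by (auto simp: clamp_to_def max_def min_def)

lemma xi_cong:
  assumes "\<And>k. k \<in> {1..n} \<Longrightarrow> x k = y k"
  shows "xi n c a x = xi n c a y"
  using assms by (simp add: xi_def)

lemma xi_permute:
  assumes "\<sigma> permutes {1..n}"
  shows "xi n (c \<circ> \<sigma>) (a \<circ> \<sigma>) (x \<circ> \<sigma>) = xi n c a x"
  using sum.permute[OF assms, of "\<lambda>k. c k * \<bar>x k - a k\<bar>"] by (simp add: xi_def o_def)

lemma xi_clamp_le:
  assumes "\<And>k. k \<in> {1..n} \<Longrightarrow> 0 \<le> c k"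
    and "\<And>k. k \<in> {1..n} \<Longrightarrow> l \<le> y k \<and> y k \<le> u"
  shows "xi n c a (\<lambda>k. clamp_to l u (a k)) \<le> xi n c a y"
  unfolding xi_def using assms by (intro sum_mono mult_left_mono clamp_to_nearest) auto

lemma unit_cube_permute:
  assumes "\<sigma> permutes {1..n}" "x \<in> unit_cube n"
  shows "x \<circ> \<sigma> \<in> unit_cube n"
proof -
  have "\<sigma> k \<in> {1..n} \<longleftrightarrow> k \<in> {1..n}" for k
    using permutes_in_image[OF assms(1)] .
  then show ?thesis
    using assms(2) unfolding unit_cube_def PiE_iff extensional_def by (simp del: atLeastAtMost_iff)
qed

text \<open>
  Two distinct indices are needed here: they make the set of differences nonempty, and they force
  \<open>\<delta>\<close> to be nonnegative when the left-hand side holds, which covers the case \<open>i = j\<close>.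
\<close>

lemma kappa_le_iff:
  assumes "n \<ge> 2"
  shows "kappa n x \<le> \<delta> \<longleftrightarrow> (\<forall>i\<in>{1..n}. \<forall>j\<in>{1..n}. x i - x j \<le> \<delta>)"
proof -
  let ?S = "{\<bar>x i - x j\<bar> |i j. 1 \<le> i \<and> i < j \<and> j \<le> n}"
  have "?S \<subseteq> (\<lambda>(i, j). \<bar>x i - x j\<bar>) ` ({1..n} \<times> {1..n})"
    by force
  then have fin: "finite ?S"
    by (rule finite_subset) simp
  have mem: "\<bar>x 1 - x 2\<bar> \<in> ?S"
    using assms by (intro CollectI exI[of _ 1] exI[of _ 2]) auto
  then have "kappa n x \<le> \<delta> \<longleftrightarrow> (\<forall>d\<in>?S. d \<le> \<delta>)"
    unfolding kappa_def using fin by (subst Max_le_iff) auto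
  also have "\<dots> \<longleftrightarrow> (\<forall>i\<in>{1..n}. \<forall>j\<in>{1..n}. x i - x j \<le> \<delta>)" (is "?L \<longleftrightarrow> ?R")
  proof
    assume L: ?L
    then have "0 \<le> \<delta>"
      using mem by (meson abs_ge_zero order_trans)
    have pair: "\<bar>x i - x j\<bar> \<le> \<delta>" if "1 \<le> i" "i < j" "j \<le> n" for i j
      using L that by blast
    show ?R
    proof (intro ballI)
      fix i j assume ij: "i \<in> {1..n}" "j \<in> {1..n}"
      consider "i < j" | "i = j" | "j < i" by linarith
      then show "x i - x j \<le> \<delta>"
        using pair[of i j] pair[of j i] ij \<open>0 \<le> \<delta>\<close> by cases auto
    qed
  next
    assume R: ?R
    show ?L
    proof
      fix d assume "d \<in> ?S"
      then obtain i j where "d = \<bar>x i - x j\<bar>" "i \<in> {1..n}" "j \<in> {1..n}"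
        by fastforce
      then show "d \<le> \<delta>"
        using R by (auto simp: abs_le_iff)
    qed
  qed
  finally show ?thesis .
qed

theorem theorem1:
  fixes n :: nat and \<delta> :: real and c a x :: "nat \<Rightarrow> real" and \<sigma> :: "nat \<Rightarrow> nat"
  assumes "n \<ge> 2"
    and "\<delta> \<in> {0..1}"
    and "c \<in> unit_cube n" and "(\<Sum>k = 1..n. c k) = 1"
    and "a \<in> unit_cube n"
    and "\<sigma> permutes {1..n}"
    and "antimono_on {1..n} (a \<circ> \<sigma>)"
    and "is_arg_min (xi n (c \<circ> \<sigma>) (a \<circ> \<sigma>))
           (\<lambda>y. y \<in> unit_cube n \<and> antimono_on {1..n} y \<and> y 1 - y n \<le> \<delta>) x"
  shows "is_arg_min (xi n c a) (\<lambda>y. y \<in> consensus_region n \<delta>) (x \<circ> inv \<sigma>)"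
proof -
  note perm = \<open>\<sigma> permutes {1..n}\<close>
  have \<sigma>_in: "\<sigma> k \<in> {1..n} \<longleftrightarrow> k \<in> {1..n}" for k
    using permutes_in_image[OF perm] .
  have inv_in: "inv \<sigma> k \<in> {1..n} \<longleftrightarrow> k \<in> {1..n}" for k
    using permutes_in_image[OF permutes_inv[OF perm]] .
  have x: "x \<in> unit_cube n" "antimono_on {1..n} x" "x 1 - x n \<le> \<delta>"
    and opt: "\<And>z. z \<in> unit_cube n \<Longrightarrow> antimono_on {1..n} z \<Longrightarrow> z 1 - z n \<le> \<delta>
      \<Longrightarrow> xi n (c \<circ> \<sigma>) (a \<circ> \<sigma>) x \<le> xi n (c \<circ> \<sigma>) (a \<circ> \<sigma>) z"
    using assms(8) unfolding is_arg_min_linorder by blast+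
  have between: "x n \<le> x k \<and> x k \<le> x 1" if "k \<in> {1..n}" for k
    using x(2) that \<open>n \<ge> 2\<close> by (auto simp: monotone_on_def)
  have feasible: "x \<circ> inv \<sigma> \<in> consensus_region n \<delta>"
    unfolding consensus_region_def kappa_le_iff[OF \<open>n \<ge> 2\<close>]
  proof (intro CollectI conjI ballI)
    show "x \<circ> inv \<sigma> \<in> unit_cube n"
      by (rule unit_cube_permute[OF permutes_inv[OF perm] x(1)])
  next
    fix i j assume "i \<in> {1..n}" "j \<in> {1..n}"
    then show "(x \<circ> inv \<sigma>) i - (x \<circ> inv \<sigma>) j \<le> \<delta>"
      using between[of "inv \<sigma> i"] between[of "inv \<sigma> j"] x(3) inv_in[of i] inv_in[of j] by simp
  qed
  have value_x: "xi n (c \<circ> \<sigma>) (a \<circ> \<sigma>) x = xi n c a (x \<circ> inv \<sigma>)"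
    using xi_permute[OF perm, of c a "x \<circ> inv \<sigma>"]
    by (simp add: comp_assoc permutes_inv_o(2)[OF perm])
  have "xi n c a (x \<circ> inv \<sigma>) \<le> xi n c a y" if y: "y \<in> consensus_region n \<delta>" for y
  proof -
    have spread: "y i - y j \<le> \<delta>" if "i \<in> {1..n}" "j \<in> {1..n}" for i j
      using y that unfolding consensus_region_def kappa_le_iff[OF \<open>n \<ge> 2\<close>] by blast
    define l u where "l = Min (y ` {1..n})" and "u = Max (y ` {1..n})"
    have ne: "y ` {1..n} \<noteq> {}"
      using \<open>n \<ge> 2\<close> by simp
    have "l \<in> y ` {1..n}" "u \<in> y ` {1..n}"
      unfolding l_def u_def using ne by (intro Min_in Max_in; simp)+
    then obtain i j where ij: "i \<in> {1..n}" "l = y i" "j \<in> {1..n}" "u = y j"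
      by blast
    have y_bounds: "l \<le> y k \<and> y k \<le> u" if "k \<in> {1..n}" for k
      using that unfolding l_def u_def by simp
    have "l \<le> u"
      using y_bounds[OF ij(1)] by linarith
    have "u - l \<le> \<delta>"
      using spread[OF ij(3,1)] ij by simp
    have "0 \<le> l" "u \<le> 1"
      using y ij unfolding consensus_region_def unit_cube_def PiE_iff by auto
    \<comment> \<open>Members of the cube are undefined outside the index set, hence the restriction.\<close>
    define z where "z = restrict (\<lambda>k. clamp_to l u (a k)) {1..n}"
    have z_bounds: "l \<le> z k \<and> z k \<le> u" if "k \<in> {1..n}" for k
      using that clamp_to_mem[OF \<open>l \<le> u\<close>] by (simp add: z_def)
    have "z k \<in> {0..1}" if "k \<in> {1..n}" for k
      using z_bounds[OF that] \<open>0 \<le> l\<close> \<open>u \<le> 1\<close> by auto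
    then have "z \<in> unit_cube n"
      unfolding unit_cube_def PiE_iff by (simp add: z_def)
    then have cube: "z \<circ> \<sigma> \<in> unit_cube n"
      by (rule unit_cube_permute[OF perm])
    have anti: "antimono_on {1..n} (z \<circ> \<sigma>)"
    proof (rule monotone_onI)
      fix i j assume "i \<in> {1..n}" "j \<in> {1..n}" "i \<le> j"
      moreover from this have "a (\<sigma> j) \<le> a (\<sigma> i)"
        using assms(7) by (auto simp: monotone_on_def)
      ultimately show "(z \<circ> \<sigma>) j \<le> (z \<circ> \<sigma>) i"
        using \<sigma>_in[of i] \<sigma>_in[of j] by (simp add: z_def clamp_to_mono)
    qed
    have "(z \<circ> \<sigma>) 1 - (z \<circ> \<sigma>) n \<le> \<delta>"
      using z_bounds[of "\<sigma> 1"] z_bounds[of "\<sigma> n"] \<sigma>_in[of 1] \<sigma>_in[of n] \<open>n \<ge> 2\<close> \<open>u - l \<le> \<delta>\<close>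
      by simp
    from opt[OF cube anti this] have "xi n c a (x \<circ> inv \<sigma>) \<le> xi n c a z"
      by (simp only: value_x xi_permute[OF perm])
    also have "\<dots> = xi n c a (\<lambda>k. clamp_to l u (a k))"
      by (rule xi_cong) (simp add: z_def)
    also have "\<dots> \<le> xi n c a y"
    proof (rule xi_clamp_le)
      show "0 \<le> c k" if "k \<in> {1..n}" for k
        using assms(3) that unfolding unit_cube_def PiE_iff by auto
    qed (rule y_bounds)
    finally show ?thesis .
  qed
  with feasible show ?thesis
    unfolding is_arg_min_linorder by blast
qed

end
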